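(* For every $n\ge 1$ and every $x>\tfrac14$, the eigenvalue equation $\det(xI_n-\mathcal{L}_n)=0$ for the truncation $\mathcal{L}_n=D_n+v_nv_n^T$ reduces to (i.e. is equivalent to) $$\sum_{i=1}^{n}\frac{1}{xp_i^2-p_i+1}=1,$$ and this last equation has exactly one solution $\rho_n$ in $\bigl(\tfrac14,+\infty\bigr)$.
   Context: $p_1<p_2<p_3<\cdots$ is the sequence of all prime numbers. $\mathcal{L}_n$ is the $n\times n$ real symmetric matrix with entries $\mathcal{L}_n[i,j]=1/\operatorname{lcm}(p_i,p_j)$, that is, $1/p_i$ if $i=j$ and $1/(p_ip_j)$ if $i\ne j$. $D_n=\operatorname{diag}\bigl((p_i-1)/p_i^2\bigr)_{i=1}^n$ and $v_n=(1/p_1,\ldots,1/p_n)^T$. $I_n$ is the $n\times n$ identity matrix. *)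

theory Defs
  imports
    "HOL-Library.Infinite_Set"
    "HOL-Computational_Algebra.Primes"
    "Jordan_Normal_Form.Determinant"
begin

text \<open>
  Indexing starts at 0, matching the rows, columns and entries of matrices and vectors:
  \<open>nth_prime i\<close> is $p_{i+1}$, so \<open>nth_prime 0 = 2\<close>, and the range $1 \le i \le n$ becomes \<open>i < n\<close>.
\<close>

definition nth_prime :: "nat \<Rightarrow> nat" where
  "nth_prime i = enumerate {p. prime p} i"

definition prime_lcm_mat :: "nat \<Rightarrow> real mat" where
  "prime_lcm_mat n = mat n n (\<lambda>(i, j). 1 / real (lcm (nth_prime i) (nth_prime j)))"

definition prime_diag_mat :: "nat \<Rightarrow> real mat" where
  "prime_diag_mat n = mat_diag n (\<lambda>i. (real (nth_prime i) - 1) / (real (nth_prime i))\<^sup>2)"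

definition prime_recip_vec :: "nat \<Rightarrow> real vec" where
  "prime_recip_vec n = vec n (\<lambda>i. 1 / real (nth_prime i))"

text \<open>The rank-one product $v w^T$ of a column and a row.\<close>

definition outer_prod :: "'a::semiring_0 vec \<Rightarrow> 'a vec \<Rightarrow> 'a mat" where
  "outer_prod v w = mat_of_cols (dim_vec v) [v] * mat_of_row w"

end

theory Submission
  imports Defs
begin

text \<open>
  Since $\operatorname{lcm}(p,q)=pq$ for distinct primes, the matrix differs from $v v^T$ only on
  the diagonal, where the defect is $1/p-1/p^2=(p-1)/p^2$.  So $xI-\mathcal{L}_n$ is a diagonal
  matrix minus a rank-one matrix.  Its diagonal part has entries $(xp^2-p+1)/p^2$, which are
  positive for $x>1/4$ because $p^2/4-p+1=(p/2-1)^2\ge 0$.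

  The determinant equation then becomes a scalar one by the kernel argument behind the secular
  equation (\<open>det_diag_minus_rank_one_eq_0_iff\<close>): a vector $y$ in the kernel of
  $E-uw^T$ satisfies $e_iy_i=u_is$ with $s=\sum_j w_jy_j$, so it is a multiple of
  $E^{-1}u$, and comparing $s$ with itself leaves the condition $\sum_i u_iw_i/e_i=1$.

  The left side of the scalar equation is continuous and strictly decreasing in $x>1/4$.  The
  term of the prime $2$ alone equals $1$ at $x=1/2$, whereas at $x=n+1$ each of the $n$ terms is
  at most $1/n$.  The intermediate value theorem and monotonicity give the unique root.
\<close>

section \<open>Diagonal matrices perturbed by a rank-one matrix\<close>

lemma dim_outer_prod [simp]:
  "dim_row (outer_prod u w) = dim_vec u" "dim_col (outer_prod u w) = dim_vec w"
  by (simp_all add: outer_prod_def mat_of_row_def)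

lemma index_outer_prod [simp]:
  assumes "i < dim_vec u" "j < dim_vec w"
  shows "outer_prod u w $$ (i, j) = u $ i * w $ j"
  using assms by (simp add: outer_prod_def scalar_prod_def mat_of_cols_def mat_of_row_def)

lemma mult_mat_vec_diag_minus_rank_one:
  fixes e :: "nat \<Rightarrow> 'a :: field"
  assumes "dim_vec u = n" "dim_vec w = n" "dim_vec y = n" "i < n"
  shows "((mat_diag n e - outer_prod u w) *\<^sub>v y) $ i
           = e i * y $ i - u $ i * (\<Sum>j<n. w $ j * y $ j)"
proof -
  have carr: "outer_prod u w \<in> carrier_mat n n"
    using assms by auto
  have "((mat_diag n e - outer_prod u w) *\<^sub>v y) $ i
          = (\<Sum>j<n. ((if i = j then e j else 0) - u $ i * w $ j) * y $ j)"
    using assms carr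
    by (auto simp: scalar_prod_def mat_diag_def lessThan_atLeast0 intro!: sum.cong)
  also have "\<dots> = (\<Sum>j<n. (if i = j then e j * y $ j else 0) - u $ i * (w $ j * y $ j))"
    by (rule sum.cong) (auto simp: algebra_simps)
  also have "\<dots> = e i * y $ i - u $ i * (\<Sum>j<n. w $ j * y $ j)"
    using assms by (simp add: sum_subtractf sum_distrib_left)
  finally show ?thesis .
qed

text \<open>
  Every kernel vector is a multiple of $(u_i/e_i)_i$, and this vector lies in the kernel exactly
  when the scalar equation holds; the equation also forces it to be nonzero.
\<close>

lemma det_diag_minus_rank_one_eq_0_iff:
  fixes e :: "nat \<Rightarrow> 'a :: field"
  assumes dims: "dim_vec u = n" "dim_vec w = n"
    and e: "\<And>i. i < n \<Longrightarrow> e i \<noteq> 0"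
  shows "Determinant.det (mat_diag n e - outer_prod u w) = 0
           \<longleftrightarrow> (\<Sum>i<n. u $ i * w $ i / e i) = 1"
    (is "Determinant.det ?A = 0 \<longleftrightarrow> _")
proof -
  have A: "?A \<in> carrier_mat n n"
    using dims by (intro minus_carrier_mat) auto
  have "Determinant.det ?A = 0 \<longleftrightarrow> (\<exists>y. y \<in> carrier_vec n \<and> y \<noteq> 0\<^sub>v n \<and> ?A *\<^sub>v y = 0\<^sub>v n)"
    by (rule det_0_iff_vec_prod_zero[OF A])
  also have "\<dots> \<longleftrightarrow> (\<Sum>i<n. u $ i * w $ i / e i) = 1"
  proof
    assume "\<exists>y. y \<in> carrier_vec n \<and> y \<noteq> 0\<^sub>v n \<and> ?A *\<^sub>v y = 0\<^sub>v n"
    then obtain y where y: "y \<in> carrier_vec n" "y \<noteq> 0\<^sub>v n" "?A *\<^sub>v y = 0\<^sub>v n"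
      by blast
    define s where "s = (\<Sum>j<n. w $ j * y $ j)"
    have y_eq: "y $ i = u $ i * s / e i" if "i < n" for i
    proof -
      have "e i * y $ i - u $ i * s = 0"
        using mult_mat_vec_diag_minus_rank_one[of u n w y i e] y dims that by (simp add: s_def)
      then show ?thesis
        using e[OF that] by (simp add: field_simps)
    qed
    have "s \<noteq> 0"
    proof
      assume "s = 0"
      then have "y = 0\<^sub>v n"
        using y(1) y_eq by (intro eq_vecI) auto
      with y(2) show False by simp
    qed
    have "s = (\<Sum>j<n. w $ j * (u $ j * s / e j))"
      unfolding s_def[symmetric] by (subst s_def, rule sum.cong) (auto simp: y_eq)
    also have "\<dots> = s * (\<Sum>j<n. u $ j * w $ j / e j)"
      by (simp add: sum_distrib_left mult_ac)
    finally show "(\<Sum>i<n. u $ i * w $ i / e i) = 1"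
      using \<open>s \<noteq> 0\<close> by simp
  next
    assume eq: "(\<Sum>i<n. u $ i * w $ i / e i) = 1"
    define y where "y = vec n (\<lambda>i. u $ i / e i)"
    have s: "(\<Sum>j<n. w $ j * y $ j) = 1"
      unfolding eq[symmetric] by (rule sum.cong) (auto simp: y_def mult_ac)
    have "y \<noteq> 0\<^sub>v n"
      using s by auto
    moreover have "?A *\<^sub>v y = 0\<^sub>v n"
    proof (rule eq_vecI)
      fix i assume "i < dim_vec (0\<^sub>v n :: 'a vec)"
      then have i: "i < n" by simp
      then show "(?A *\<^sub>v y) $ i = 0\<^sub>v n $ i"
        using mult_mat_vec_diag_minus_rank_one[of u n w y i e] dims e[OF i] s
        by (simp add: y_def)
    qed (use dims in simp)
    moreover have "y \<in> carrier_vec n"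
      by (simp add: y_def)
    ultimately show "\<exists>y. y \<in> carrier_vec n \<and> y \<noteq> 0\<^sub>v n \<and> ?A *\<^sub>v y = 0\<^sub>v n"
      by blast
  qed
  finally show ?thesis .
qed

section \<open>The reciprocal lcm matrix of the primes\<close>

lemma prime_nth_prime: "prime (nth_prime i)"
  using enumerate_in_set[OF primes_infinite] by (simp add: nth_prime_def)

lemma inj_nth_prime: "inj nth_prime"
  using strict_mono_enumerate[OF primes_infinite]
  by (auto simp: nth_prime_def[abs_def] intro: strict_mono_imp_inj_on)

lemma nth_prime_ge_2: "real (nth_prime i) \<ge> 2"
  using prime_ge_2_nat[OF prime_nth_prime[of i]] by linarith

lemma nth_prime_0: "nth_prime 0 = 2"
  unfolding nth_prime_def enumerate_0
  by (rule Least_equality) (auto simp: prime_ge_2_nat)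

lemma prime_lcm_mat_eq:
  "prime_lcm_mat n = prime_diag_mat n + outer_prod (prime_recip_vec n) (prime_recip_vec n)"
    (is "_ = _ + ?R")
proof (rule eq_matI)
  have R: "?R \<in> carrier_mat n n"
    by (auto simp: prime_recip_vec_def)
  show "dim_row (prime_lcm_mat n) = dim_row (prime_diag_mat n + ?R)"
    "dim_col (prime_lcm_mat n) = dim_col (prime_diag_mat n + ?R)"
    by (simp_all add: prime_lcm_mat_def prime_recip_vec_def)
  fix i j
  assume "i < dim_row (prime_diag_mat n + ?R)" "j < dim_col (prime_diag_mat n + ?R)"
  then have ij: "i < n" "j < n"
    using R by auto
  have rhs: "(prime_diag_mat n + ?R) $$ (i, j)
      = (if i = j then (real (nth_prime i) - 1) / (real (nth_prime i))\<^sup>2 else 0)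
        + 1 / real (nth_prime i) * (1 / real (nth_prime j))"
    using ij R by (auto simp: prime_diag_mat_def mat_diag_def prime_recip_vec_def)
  show "prime_lcm_mat n $$ (i, j) = (prime_diag_mat n + ?R) $$ (i, j)"
  proof (cases "i = j")
    case True
    then show ?thesis
      unfolding rhs using ij nth_prime_ge_2[of i]
      by (simp add: prime_lcm_mat_def field_simps power2_eq_square)
  next
    case False
    then have "nth_prime i \<noteq> nth_prime j"
      using inj_nth_prime by (simp add: inj_eq)
    then have "lcm (nth_prime i) (nth_prime j) = nth_prime i * nth_prime j"
      by (simp add: lcm_coprime primes_coprime prime_nth_prime)
    then show ?thesis
      unfolding rhs using ij False by (simp add: prime_lcm_mat_def)
  qed
qed

section \<open>The scalar equation\<close>

text \<open>The double root of $p^2/4-p+1$ at $p=2$ is what makes $1/4$ the threshold.\<close>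

lemma secular_denom_pos:
  fixes p x :: real
  assumes "x > 1 / 4" "p > 0"
  shows "x * p\<^sup>2 - p + 1 > 0"
proof -
  have "0 \<le> (p / 2 - 1)\<^sup>2"
    by simp
  also have "\<dots> = 1 / 4 * p\<^sup>2 - p + 1"
    by (simp add: power2_eq_square algebra_simps)
  also have "\<dots> < x * p\<^sup>2 - p + 1"
    using assms by simp
  finally show ?thesis .
qed

lemma det_prime_lcm_mat_eq_0_iff:
  fixes x :: real
  assumes x: "x > 1 / 4"
  shows "Determinant.det (x \<cdot>\<^sub>m 1\<^sub>m n - prime_lcm_mat n) = 0 \<longleftrightarrow>
         (\<Sum>i<n. 1 / (x * (real (nth_prime i))\<^sup>2 - real (nth_prime i) + 1)) = 1"
proof -
  define e where "e i = x - (real (nth_prime i) - 1) / (real (nth_prime i))\<^sup>2" for i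
  let ?v = "prime_recip_vec n"
  have dim: "dim_vec ?v = n"
    by (simp add: prime_recip_vec_def)
  have R: "outer_prod ?v ?v \<in> carrier_mat n n"
    using dim by auto
  have e_eq: "e i = (x * (real (nth_prime i))\<^sup>2 - real (nth_prime i) + 1) / (real (nth_prime i))\<^sup>2" for i
    using nth_prime_ge_2[of i] by (simp add: e_def field_simps)
  have e_nz: "e i \<noteq> 0" for i
    using secular_denom_pos[OF x, of "real (nth_prime i)"] nth_prime_ge_2[of i]
    by (simp add: e_eq)
  have "x \<cdot>\<^sub>m 1\<^sub>m n - prime_lcm_mat n = mat_diag n e - outer_prod ?v ?v"
    unfolding prime_lcm_mat_eq
    using R by (intro eq_matI) (auto simp: prime_diag_mat_def mat_diag_def e_def)
  moreover have "?v $ i * ?v $ i / e i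
      = 1 / (x * (real (nth_prime i))\<^sup>2 - real (nth_prime i) + 1)" if "i < n" for i
    using that nth_prime_ge_2[of i]
    by (simp add: prime_recip_vec_def e_eq power2_eq_square)
  ultimately show ?thesis
    using det_diag_minus_rank_one_eq_0_iff[of ?v n ?v e] dim e_nz by simp
qed

lemma secular_sum_strict_decreasing:
  fixes x y :: real
  assumes "1 / 4 < x" "x < y" "n \<ge> 1"
  shows "(\<Sum>i<n. 1 / (y * (real (nth_prime i))\<^sup>2 - real (nth_prime i) + 1))
           < (\<Sum>i<n. 1 / (x * (real (nth_prime i))\<^sup>2 - real (nth_prime i) + 1))"
proof (rule sum_strict_mono)
  fix i
  let ?p = "real (nth_prime i)"
  have p: "?p > 0"
    using nth_prime_ge_2[of i] by simp
  have "0 < x * ?p\<^sup>2 - ?p + 1"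
    using secular_denom_pos assms(1) p by blast
  moreover have "x * ?p\<^sup>2 - ?p + 1 < y * ?p\<^sup>2 - ?p + 1"
    using assms(2) p by simp
  ultimately show "1 / (y * ?p\<^sup>2 - ?p + 1) < 1 / (x * ?p\<^sup>2 - ?p + 1)"
    by (intro divide_strict_left_mono) auto
qed (use assms in \<open>auto simp: lessThan_empty_iff\<close>)

lemma ex1_secular_root:
  assumes n: "n \<ge> 1"
  shows "\<exists>!\<rho>::real. \<rho> > 1 / 4 \<and>
           (\<Sum>i<n. 1 / (\<rho> * (real (nth_prime i))\<^sup>2 - real (nth_prime i) + 1)) = 1"
proof -
  define f where "f x = (\<Sum>i<n. 1 / (x * (real (nth_prime i))\<^sup>2 - real (nth_prime i) + 1))"
    for x :: real
  have denom_pos: "x * (real (nth_prime i))\<^sup>2 - real (nth_prime i) + 1 > 0" if "x > 1 / 4" for x i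
    using secular_denom_pos[OF that] nth_prime_ge_2[of i] by simp
  have lower: "1 \<le> f (1 / 2)"
  proof -
    have "1 = 1 / (1 / 2 * (real (nth_prime 0))\<^sup>2 - real (nth_prime 0) + 1)"
      by (simp add: nth_prime_0)
    also have "\<dots> \<le> f (1 / 2)"
      unfolding f_def using n denom_pos[of "1 / 2"]
      by (intro member_le_sum[where i = 0 and A = "{..<n}"
            and f = "\<lambda>i. 1 / (1 / 2 * (real (nth_prime i))\<^sup>2 - real (nth_prime i) + 1)"])
        (auto intro: less_imp_le)
    finally show ?thesis .
  qed
  have upper: "f (real n + 1) \<le> 1"
  proof -
    have "f (real n + 1) \<le> (\<Sum>i<n. 1 / real n)"
      unfolding f_def
    proof (rule sum_mono)
      fix i
      let ?p = "real (nth_prime i)"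
      have p: "1 \<le> ?p" "?p \<le> ?p\<^sup>2"
        using nth_prime_ge_2[of i] by (auto simp: power2_eq_square)
      then have "real n * 1 \<le> real n * ?p\<^sup>2"
        by (intro mult_left_mono) auto
      then have "real n \<le> (real n + 1) * ?p\<^sup>2 - ?p + 1"
        using p unfolding distrib_right by linarith
      then show "1 / ((real n + 1) * ?p\<^sup>2 - ?p + 1) \<le> 1 / real n"
        using n by (intro divide_left_mono) auto
    qed
    also have "\<dots> = 1"
      using n by simp
    finally show ?thesis .
  qed
  have "continuous_on {1 / 2..real n + 1} f"
    unfolding f_def
  proof (intro continuous_intros ballI)
    fix i x assume "x \<in> {1 / 2..real n + 1}"
    then show "x * (real (nth_prime i))\<^sup>2 - real (nth_prime i) + 1 \<noteq> 0"
      using denom_pos[of x i] by simp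
  qed
  then obtain r where r: "1 / 2 \<le> r" "f r = 1"
    using IVT2'[of f "real n + 1" 1 "1 / 2"] lower upper by auto
  have "s = r" if "s > 1 / 4" "f s = 1" for s
    using that r secular_sum_strict_decreasing[of s r n] secular_sum_strict_decreasing[of r s n] n
    by (cases s r rule: linorder_cases) (auto simp: f_def)
  then show ?thesis
    using r unfolding f_def[symmetric] by (intro ex1I[of _ r]) auto
qed

theorem lemma5p3:
  fixes n :: nat
  assumes "n \<ge> 1"
  shows "prime_lcm_mat n
           = prime_diag_mat n + outer_prod (prime_recip_vec n) (prime_recip_vec n)
       \<and> (\<forall>x::real. x > 1 / 4 \<longrightarrow>
            (Determinant.det (x \<cdot>\<^sub>m 1\<^sub>m n - prime_lcm_mat n) = 0 \<longleftrightarrow>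
             (\<Sum>i<n. 1 / (x * (real (nth_prime i))\<^sup>2 - real (nth_prime i) + 1)) = 1))
       \<and> (\<exists>!\<rho>::real. \<rho> > 1 / 4 \<and>
            (\<Sum>i<n. 1 / (\<rho> * (real (nth_prime i))\<^sup>2 - real (nth_prime i) + 1)) = 1)"
  using prime_lcm_mat_eq det_prime_lcm_mat_eq_0_iff ex1_secular_root[OF assms] by blast

end
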